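(* Let $(X,d)$ be an ultrametric space. Then the following statements are equivalent: (1) The space $(X,d)$ is boundedly compact. (2) The space $(\bar{\mathbf{B}}_X, d_H)$ is boundedly compact.
   Context: Metric spaces are nonempty. An ultrametric space is a metric space $(X,d)$ with $d(x,y)\le\max\{d(x,z),d(z,y)\}$ for all $x,y,z\in X$. For $c\in X$ and $r\ge 0$ the closed ball is $\bar B_r(c)=\{x\in X: d(c,x)\le r\}$ (so $\bar B_0(c)=\{c\}$). $\bar{\mathbf{B}}_X$ is the set of all closed balls $\bar B_r(c)$, $c\in X$, $r\ge 0$, regarded as subsets of $X$. The Hausdorff distance between nonempty closed bounded sets $A,B\subseteq X$ is $d_H(A,B)=\max\{\sup_{a\in A}\inf_{b\in B}d(a,b),\ \sup_{b\in B}\inf_{a\in A}d(a,b)\}$; $\bar{\mathbf{B}}_X$ is equipped with the metric $d_H$. A metric space is boundedly compact if every closed and bounded subset of it is compact. *)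

theory Defs
  imports "HOL-Analysis.Abstract_Metric_Spaces"
begin

locale Ultrametric_space = Metric_space +
  assumes nonempty: "M \<noteq> {}"
    and ultrametric: "\<And>x y z. \<lbrakk>x \<in> M; y \<in> M; z \<in> M\<rbrakk> \<Longrightarrow> d x y \<le> max (d x z) (d z y)"

context Metric_space
begin

definition boundedly_compact :: bool where
  "boundedly_compact \<longleftrightarrow> (\<forall>S. closedin mtopology S \<and> mbounded S \<longrightarrow> compactin mtopology S)"

definition closed_balls :: "'a set set" where
  "closed_balls = {mcball c r | c r. c \<in> M \<and> 0 \<le> r}"

definition CB :: "'a set set" where
  "CB = {A. A \<noteq> {} \<and> closedin mtopology A \<and> mbounded A}"

text \<open>The value 0 outside \<open>CB\<close> is a dummy: the locale \<^locale>\<open>Metric_space\<close> requires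
  distances to be nonnegative and symmetric also outside the carrier, and real suprema of
  unbounded sets are unspecified.\<close>

definition hausdorff_dist :: "'a set \<Rightarrow> 'a set \<Rightarrow> real" where
  "hausdorff_dist A B =
     (if A \<in> CB \<and> B \<in> CB
      then max (SUP a\<in>A. INF b\<in>B. d a b) (SUP b\<in>B. INF a\<in>A. d a b)
      else 0)"

lemma closed_balls_subset_CB: "closed_balls \<subseteq> CB"
  by (auto simp: closed_balls_def CB_def mbounded_mcball mcball_eq_empty simp del: in_mcball)

lemma CB_subset: "A \<in> CB \<Longrightarrow> A \<subseteq> M"
  by (auto simp: CB_def dest: mbounded_subset_mspace)

lemma Inf_dist_bdd: "bdd_below (d a ` B)"
  by (rule bdd_belowI[of _ 0]) auto

lemma Inf_dist_le: "b \<in> B \<Longrightarrow> (INF b\<in>B. d a b) \<le> d a b"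
  by (rule cINF_lower[OF Inf_dist_bdd])

lemma Inf_dist_nonneg: "B \<noteq> {} \<Longrightarrow> 0 \<le> (INF b\<in>B. d a b)"
  by (rule cINF_greatest) auto

lemma Inf_dist_triangle:
  assumes "C \<noteq> {}" "C \<subseteq> M" "a \<in> M" "b \<in> M"
  shows "(INF c\<in>C. d a c) \<le> d a b + (INF c\<in>C. d b c)"
proof -
  have "(INF c\<in>C. d a c) - d a b \<le> (INF c\<in>C. d b c)"
  proof (rule cINF_greatest[OF assms(1)])
    fix c assume c: "c \<in> C"
    then have "d a c \<le> d a b + d b c" using assms by (intro triangle) auto
    then show "(INF c\<in>C. d a c) - d a b \<le> d b c"
      using Inf_dist_le[OF c, of a] by linarith
  qed
  then show ?thesis by linarith
qed

lemma Sup_Inf_dist_upper: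
  assumes "A \<in> CB" "B \<in> CB" "a \<in> A"
  shows "(INF b\<in>B. d a b) \<le> (SUP a\<in>A. INF b\<in>B. d a b)"
proof (rule cSUP_upper[OF assms(3)])
  obtain b where b: "b \<in> B" using assms by (auto simp: CB_def)
  have "mbounded (A \<union> B)" using assms by (auto simp: CB_def mbounded_Un)
  then obtain K where K: "\<forall>x\<in>A \<union> B. \<forall>y\<in>A \<union> B. d x y \<le> K"
    by (auto simp: mbounded_alt)
  show "bdd_above ((\<lambda>a. INF b\<in>B. d a b) ` A)"
  proof (rule bdd_aboveI2)
    fix a assume "a \<in> A"
    then show "(INF b\<in>B. d a b) \<le> K"
      using Inf_dist_le[OF b, of a] K b by force
  qed
qed

lemma Sup_Inf_dist_triangle:
  assumes A: "A \<in> CB" and B: "B \<in> CB" and C: "C \<in> CB"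
  shows "(SUP a\<in>A. INF c\<in>C. d a c) \<le>
         (SUP a\<in>A. INF b\<in>B. d a b) + (SUP b\<in>B. INF c\<in>C. d b c)"
proof (rule cSUP_least)
  show "A \<noteq> {}" using A by (simp add: CB_def)
  fix a assume a: "a \<in> A"
  have "(INF c\<in>C. d a c) - (SUP b\<in>B. INF c\<in>C. d b c) \<le> (INF b\<in>B. d a b)"
  proof (rule cINF_greatest)
    show "B \<noteq> {}" using B by (simp add: CB_def)
    fix b assume b: "b \<in> B"
    have "(INF c\<in>C. d a c) \<le> d a b + (INF c\<in>C. d b c)"
      by (rule Inf_dist_triangle) (use a b A B C CB_subset in \<open>auto simp: CB_def\<close>)
    then show "(INF c\<in>C. d a c) - (SUP b\<in>B. INF c\<in>C. d b c) \<le> d a b"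
      using Sup_Inf_dist_upper[OF B C b] by linarith
  qed
  then show "(INF c\<in>C. d a c) \<le>
      (SUP a\<in>A. INF b\<in>B. d a b) + (SUP b\<in>B. INF c\<in>C. d b c)"
    using Sup_Inf_dist_upper[OF A B a] by linarith
qed

lemma Sup_Inf_dist_nonneg:
  assumes "A \<in> CB" "B \<in> CB"
  shows "0 \<le> (SUP a\<in>A. INF b\<in>B. d a b)"
proof -
  obtain a where a: "a \<in> A" using assms by (auto simp: CB_def)
  have "0 \<le> (INF b\<in>B. d a b)" using assms by (intro Inf_dist_nonneg) (auto simp: CB_def)
  also have "\<dots> \<le> (SUP a\<in>A. INF b\<in>B. d a b)" by (rule Sup_Inf_dist_upper[OF assms a])
  finally show ?thesis .
qed

lemma Sup_Inf_dist_le_0_imp_subset: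
  assumes "A \<in> CB" "B \<in> CB" and le: "(SUP a\<in>A. INF b\<in>B. d a b) \<le> 0"
  shows "A \<subseteq> B"
proof
  fix a assume a: "a \<in> A"
  have i: "(INF b\<in>B. d a b) \<le> 0"
    using Sup_Inf_dist_upper[OF assms(1,2) a] le by linarith
  have aM: "a \<in> M" using a assms(1) CB_subset by auto
  have ne: "B \<noteq> {}" and BM: "B \<subseteq> M" and cl: "closedin mtopology B"
    using assms(2) CB_subset by (auto simp: CB_def)
  show "a \<in> B"
  proof (rule ccontr)
    assume "a \<notin> B"
    then obtain r where r: "r > 0" "disjnt B (mball a r)"
      using cl aM unfolding closedin_metric by auto
    have "r \<le> (INF b\<in>B. d a b)"
    proof (rule cINF_greatest[OF ne])
      fix b assume "b \<in> B"
      then show "r \<le> d a b" using r(2) BM aM by (force simp: disjnt_iff)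
    qed
    with i r(1) show False by linarith
  qed
qed

lemma Sup_Inf_dist_self: "A \<in> CB \<Longrightarrow> (SUP a\<in>A. INF b\<in>A. d a b) = 0"
proof -
  assume A: "A \<in> CB"
  have "(SUP a\<in>A. INF b\<in>A. d a b) \<le> 0"
  proof (rule cSUP_least)
    show "A \<noteq> {}" using A by (simp add: CB_def)
    fix a assume a: "a \<in> A"
    then have "a \<in> M" using A CB_subset by auto
    then show "(INF b\<in>A. d a b) \<le> 0" using Inf_dist_le[OF a, of a] by simp
  qed
  then show ?thesis using Sup_Inf_dist_nonneg[OF A A] by linarith
qed

lemma Metric_space_CB: "Metric_space CB hausdorff_dist"
proof
  fix A B :: "'a set"
  show "0 \<le> hausdorff_dist A B"
    using Sup_Inf_dist_nonneg[of A B] by (auto simp: hausdorff_dist_def le_max_iff_disj)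
  have flip: "(SUP b\<in>B. INF a\<in>A. d a b) = (SUP b\<in>B. INF a\<in>A. d b a)" for A B
    by (simp add: commute)
  show "hausdorff_dist A B = hausdorff_dist B A"
    by (simp add: hausdorff_dist_def flip max.commute)
  assume A: "A \<in> CB" and B: "B \<in> CB"
  show "hausdorff_dist A B = 0 \<longleftrightarrow> A = B"
  proof
    assume "hausdorff_dist A B = 0"
    then have "(SUP a\<in>A. INF b\<in>B. d a b) \<le> 0" "(SUP b\<in>B. INF a\<in>A. d b a) \<le> 0"
      using A B by (auto simp: hausdorff_dist_def flip)
    then show "A = B" using Sup_Inf_dist_le_0_imp_subset A B by blast
  next
    assume "A = B"
    then show "hausdorff_dist A B = 0"
      using A by (simp add: hausdorff_dist_def flip Sup_Inf_dist_self)
  qed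
next
  fix A B C assume A: "A \<in> CB" and B: "B \<in> CB" and C: "C \<in> CB"
  have flip: "(SUP b\<in>B. INF a\<in>A. d a b) = (SUP b\<in>B. INF a\<in>A. d b a)" for A B
    by (simp add: commute)
  show "hausdorff_dist A C \<le> hausdorff_dist A B + hausdorff_dist B C"
    using Sup_Inf_dist_triangle[OF A B C] Sup_Inf_dist_triangle[OF C B A] A B C
    unfolding hausdorff_dist_def flip by (simp only: if_True simp_thms)
qed

text \<open>Hence the space of closed balls is a metric space, so the constants
  \<open>Metric_space.mtopology\<close>, \<open>Metric_space.mbounded\<close> etc. have their intended meaning for it.\<close>

lemma Metric_space_closed_balls: "Metric_space closed_balls hausdorff_dist"
  by (rule Metric_space.subspace[OF Metric_space_CB closed_balls_subset_CB])

end

end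

theory Submission
  imports Defs
begin

text \<open>If \<open>X\<close> is boundedly compact, a bounded set of balls lies in a single ball \<open>K\<close>, which is
  totally bounded. Since balls in an ultrametric space are either disjoint or nested, a ball in
  \<open>K\<close> of radius at least \<open>\<epsilon>\<close> is determined by which points of a finite \<open>\<epsilon>\<close>-net of \<open>K\<close> it contains,
  so there are finitely many of them. Hence a sequence of balls in \<open>K\<close> either has a constant
  subsequence or has radii tending to 0, and in the latter case it converges to a singleton along
  any subsequence for which the centres converge. Conversely, \<open>x \<mapsto> {x}\<close> embeds \<open>X\<close> isometrically onto
  a closed subset of the space of balls.\<close>

section \<open>Pointwise estimates for the Hausdorff distance, and singletons\<close>

context Metric_space
begin

lemma hausdorff_dist_le:
  assumes A: "A \<in> CB" and B: "B \<in> CB"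
    and AB: "\<And>a. a \<in> A \<Longrightarrow> \<exists>b\<in>B. d a b \<le> e" and BA: "\<And>b. b \<in> B \<Longrightarrow> \<exists>a\<in>A. d a b \<le> e"
  shows "hausdorff_dist A B \<le> e"
proof -
  have ne: "A \<noteq> {}" "B \<noteq> {}"
    using A B by (auto simp: CB_def)
  have "(SUP a\<in>A. INF b\<in>B. d a b) \<le> e"
    using AB by (intro cSUP_least ne) (metis Inf_dist_le order_trans)
  moreover have "(SUP b\<in>B. INF a\<in>A. d b a) \<le> e"
    using BA by (intro cSUP_least ne) (metis Inf_dist_le commute order_trans)
  ultimately show ?thesis
    using A B by (simp add: hausdorff_dist_def commute)
qed

text \<open>The infimum over \<open>B\<close> need not be attained; strictness of the bound is what
  yields an actual point \<open>b\<close>.\<close>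

lemma hausdorff_dist_less_imp:
  assumes A: "A \<in> CB" and B: "B \<in> CB" and less: "hausdorff_dist A B < e" and a: "a \<in> A"
  shows "\<exists>b\<in>B. d a b < e"
proof -
  have "(INF b\<in>B. d a b) < e"
    using Sup_Inf_dist_upper[OF A B a] less A B by (simp add: hausdorff_dist_def)
  moreover have "B \<noteq> {}"
    using B by (simp add: CB_def)
  ultimately show ?thesis
    using cINF_less_iff[OF _ Inf_dist_bdd] by blast
qed

lemma singleton_in_closed_balls: "x \<in> M \<Longrightarrow> {x} \<in> closed_balls"
proof -
  assume x: "x \<in> M"
  then have "{x} = mcball x 0"
    by (auto simp: mcball_def) (metis nonneg order_antisym zero)
  with x show ?thesis
    unfolding closed_balls_def by blast
qed

lemma hausdorff_dist_commute: "hausdorff_dist A B = hausdorff_dist B A"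
  by (rule Metric_space.commute[OF Metric_space_CB])

text \<open>Every \<open>b \<in> B\<close> is within \<open>e\<close> of some point of
  \<open>{x}\<close>, which can only be \<open>x\<close>. So the bound is uniform on
  \<open>B\<close>.\<close>

lemma hausdorff_dist_singleton_less_imp:
  assumes x: "x \<in> M" and B: "B \<in> CB" and less: "hausdorff_dist {x} B < e" and b: "b \<in> B"
  shows "d x b < e"
  using hausdorff_dist_less_imp[OF B _ _ b, of "{x}" e] singleton_in_closed_balls[OF x]
    closed_balls_subset_CB less hausdorff_dist_commute commute by auto

lemma hausdorff_dist_singletons:
  assumes x: "x \<in> M" and y: "y \<in> M"
  shows "hausdorff_dist {x} {y} = d x y"
proof (rule antisym)
  have CB: "{x} \<in> CB" "{y} \<in> CB"
    using x y singleton_in_closed_balls closed_balls_subset_CB by auto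
  show "hausdorff_dist {x} {y} \<le> d x y"
    using CB by (intro hausdorff_dist_le) auto
  show "d x y \<le> hausdorff_dist {x} {y}"
    using hausdorff_dist_singleton_less_imp[OF x CB(2)]
    by (metis insertI1 less_irrefl not_le)
qed

interpretation balls: Metric_space closed_balls hausdorff_dist
  by (rule Metric_space_closed_balls)

section \<open>Boundedness and limits in the space of balls\<close>

lemma mbounded_Union_balls:
  assumes "balls.mbounded S"
  shows "mbounded (\<Union>S)"
proof (cases "S = {}")
  case True
  then show ?thesis by simp
next
  case False
  then obtain C R where S: "S \<subseteq> balls.mcball C R"
    using assms by (auto simp: balls.mbounded_def)
  with False have "C \<in> closed_balls"
    by auto
  then obtain c r where C: "C = mcball c r" and c: "c \<in> M"
    by (auto simp: closed_balls_def)
  \<comment> \<open>The extra 1 turns \<open>hausdorff_dist A C \<le> R\<close> into a strict bound,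
    so that some \<open>b \<in> C\<close> is near \<open>a\<close>; every such \<open>b\<close> is
    within \<open>r\<close> of \<open>c\<close>.\<close>
  have "d c a \<le> r + (R + 1)" if AS: "A \<in> S" and aA: "a \<in> A" for A a
  proof -
    have A: "A \<in> closed_balls" "hausdorff_dist A C < R + 1"
      using S AS hausdorff_dist_commute[of A C] by force+
    then obtain b where b: "b \<in> C" "d a b < R + 1"
      using hausdorff_dist_less_imp[of A C "R + 1" a] aA closed_balls_subset_CB
        \<open>C \<in> closed_balls\<close> by blast
    have "a \<in> M"
      using A aA closed_balls_subset_CB CB_subset by blast
    then show ?thesis
      using triangle[of c b a] b C c by (simp add: commute)
  qed
  moreover have "\<Union>S \<subseteq> M"
    using S closed_balls_subset_CB CB_subset by force
  ultimately have "\<Union>S \<subseteq> mcball c (r + (R + 1))"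
    using c by auto
  then show ?thesis
    by (auto simp: mbounded_def)
qed

text \<open>Each point of \<open>B\<close> is a limit of \<open>\<sigma>\<close>, so uniqueness of
  limits leaves only one. This serves both to show that singletons of points of a closed set form a
  closed set and to turn limits of singletons back into limits of points.\<close>

lemma limitin_singletonsD:
  assumes \<sigma>: "range \<sigma> \<subseteq> M" and lim: "limitin balls.mtopology (\<lambda>n. {\<sigma> n}) B sequentially"
  obtains b where "B = {b}" "b \<in> M" "limitin mtopology \<sigma> b sequentially"
proof -
  have B: "B \<in> CB"
    using lim closed_balls_subset_CB by (auto simp: balls.limitin_metric)
  then obtain b where b: "b \<in> B" and BM: "B \<subseteq> M"
    using CB_subset by (auto simp: CB_def)
  have ev: "\<forall>\<^sub>F n in sequentially. \<forall>x\<in>B. d (\<sigma> n) x < e" if "e > 0" for e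
  proof -
    have "\<forall>\<^sub>F n in sequentially. hausdorff_dist {\<sigma> n} B < e"
      using lim that by (auto simp: balls.limitin_metric elim: eventually_mono)
    then show ?thesis
      using hausdorff_dist_singleton_less_imp[OF range_subsetD[OF \<sigma>] B] by (auto elim!: eventually_mono)
  qed
  have limb: "limitin mtopology \<sigma> x sequentially" if "x \<in> B" for x
    unfolding limitin_metric
  proof (intro conjI strip)
    show "x \<in> M"
      using that BM by blast
    show "\<forall>\<^sub>F n in sequentially. \<sigma> n \<in> M \<and> d (\<sigma> n) x < e" if "e > 0" for e
      using eventually_mono[OF ev[OF that]] \<open>x \<in> B\<close> \<sigma> by (simp add: range_subsetD)
  qed
  have "B = {b}"
    using limb b limitin_metric_unique trivial_limit_sequentially by blast
  with b BM limb that show thesis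
    by blast
qed

section \<open>Bounded compactness passes from the balls to the points\<close>

lemma boundedly_compact_if_balls:
  assumes bc: "balls.boundedly_compact"
  shows "boundedly_compact"
  unfolding boundedly_compact_def compactin_sequentially
proof (intro strip conjI)
  fix S assume "closedin mtopology S \<and> mbounded S"
  then have cl: "closedin mtopology S" and bdd: "mbounded S"
    by auto
  show SM: "S \<subseteq> M"
    using bdd by (rule mbounded_subset_mspace)
  \<comment> \<open>An isometric copy of \<open>S\<close>: it is shown to be closed and bounded,
    hence compact, and convergent subsequences are then pulled back to \<open>S\<close>.\<close>
  let ?T = "(\<lambda>x. {x}) ` S"
  have "closedin balls.mtopology ?T"
    unfolding balls.metric_closedin_iff_sequentially_closed
  proof (intro strip conjI)
    show "?T \<subseteq> closed_balls"
      using SM singleton_in_closed_balls by blast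
    fix \<sigma> B assume "range \<sigma> \<subseteq> ?T \<and> limitin balls.mtopology \<sigma> B sequentially"
    then have \<sigma>: "\<And>n. \<exists>x\<in>S. \<sigma> n = {x}" and lim: "limitin balls.mtopology \<sigma> B sequentially"
      by auto
    from \<sigma> obtain x where x: "\<And>n. x n \<in> S" "\<sigma> = (\<lambda>n. {x n})"
      by metis
    then obtain b where "B = {b}" "limitin mtopology x b sequentially"
      using limitin_singletonsD[of x B] lim SM by blast
    then show "B \<in> ?T"
      using x cl unfolding metric_closedin_iff_sequentially_closed by blast
  qed
  moreover have "balls.mbounded ?T"
  proof -
    obtain B where "\<forall>x\<in>S. \<forall>y\<in>S. d x y \<le> B"
      using bdd by (auto simp: mbounded_alt)
    then have "\<forall>P\<in>?T. \<forall>Q\<in>?T. hausdorff_dist P Q \<le> B"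
      using SM by (auto simp: hausdorff_dist_singletons subset_iff)
    then show ?thesis
      using SM singleton_in_closed_balls unfolding balls.mbounded_alt by blast
  qed
  ultimately have cpt: "compactin balls.mtopology ?T"
    using bc by (simp add: balls.boundedly_compact_def)
  fix \<sigma> :: "nat \<Rightarrow> 'a" assume \<sigma>: "range \<sigma> \<subseteq> S"
  then have "range (\<lambda>n. {\<sigma> n}) \<subseteq> ?T"
    by blast
  then obtain B r where B: "B \<in> ?T" and r: "strict_mono r"
    and lim: "limitin balls.mtopology ((\<lambda>n. {\<sigma> n}) \<circ> r) B sequentially"
    using cpt unfolding balls.compactin_sequentially by meson
  have "range (\<sigma> \<circ> r) \<subseteq> M"
    using \<sigma> SM by auto
  then obtain b where "B = {b}" "limitin mtopology (\<sigma> \<circ> r) b sequentially"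
    using limitin_singletonsD[of "\<sigma> \<circ> r" B] lim by (auto simp: o_def)
  with B r show "\<exists>l r. l \<in> S \<and> strict_mono r \<and> limitin mtopology (\<sigma> \<circ> r) l sequentially"
    by blast
qed

end

section \<open>Closed balls under the strong triangle inequality\<close>

context Ultrametric_space
begin

interpretation balls: Metric_space closed_balls hausdorff_dist
  by (rule Metric_space_closed_balls)

text \<open>Going from \<open>c\<close> to \<open>x\<close> through \<open>a\<close> costs a maximum
  instead of a sum, so the radius does not grow. With \<open>s = r\<close> this makes every point of
  a ball a centre of it.\<close>

lemma mcball_subset_mcball:
  assumes "a \<in> mcball c r" "s \<le> r"
  shows "mcball a s \<subseteq> mcball c r"
proof
  fix x assume x: "x \<in> mcball a s"
  then have "d c x \<le> max (d c a) (d a x)"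
    using assms(1) by (intro ultrametric) (simp_all only: in_mcball)
  moreover have "d c a \<le> r" "d a x \<le> r"
    using x assms by auto
  ultimately show "x \<in> mcball c r"
    using x assms(1) by (simp only: in_mcball max.bounded_iff) linarith
qed

lemma finite_large_balls:
  assumes K: "mtotally_bounded K" and e: "e > 0"
  shows "finite {A. A \<subseteq> K \<and> (\<exists>c r. c \<in> M \<and> e \<le> r \<and> A = mcball c r)}" (is "finite ?L")
proof -
  obtain F where F: "finite F" "F \<subseteq> K" "K \<subseteq> (\<Union>x\<in>F. mball x e)"
    using K e unfolding mtotally_bounded_def by meson
  \<comment> \<open>The trace \<open>A \<inter> F\<close> determines \<open>A\<close>: a net point
    within \<open>e \<le> r\<close> of a point of \<open>A\<close> lies in \<open>A\<close> itself,
    and conversely the \<open>e\<close>-ball around a point of \<open>A\<close> stays in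
    \<open>A\<close>.\<close>
  have "A = K \<inter> (\<Union>f\<in>A \<inter> F. mcball f e)" if "A \<in> ?L" for A
  proof -
    from that obtain c r where A: "A \<subseteq> K" "A = mcball c r" and r: "e \<le> r"
      by auto
    show ?thesis
    proof (intro equalityI subsetI)
      fix a assume a: "a \<in> A"
      then obtain f where f: "f \<in> F" "a \<in> mball f e"
        using A F by blast
      then have "f \<in> mcball a e"
        by (auto simp: commute)
      then have "f \<in> A"
        using mcball_subset_mcball a r A by blast
      with f a A show "a \<in> K \<inter> (\<Union>f\<in>A \<inter> F. mcball f e)"
        by force
    next
      fix a assume "a \<in> K \<inter> (\<Union>f\<in>A \<inter> F. mcball f e)"
      then show "a \<in> A"
        using mcball_subset_mcball A r by blast
    qed
  qed
  then have "?L \<subseteq> (\<lambda>G. K \<inter> (\<Union>f\<in>G. mcball f e)) ` Pow F"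
    by blast
  with F show ?thesis
    by (meson finite_Pow_iff finite_imageI finite_subset)
qed

text \<open>By the strong triangle inequality all points of the ball are within
  \<open>max (r n) (d (a n) l)\<close> of \<open>l\<close>, and the centre \<open>a n\<close> is a
  point near \<open>l\<close> for the other half of the Hausdorff distance.\<close>

lemma limitin_shrinking_balls:
  assumes a: "limitin mtopology a l sequentially" and aM: "range a \<subseteq> M" and r: "\<And>n. 0 \<le> r n"
    and small: "\<And>e. e > 0 \<Longrightarrow> \<forall>\<^sub>F n in sequentially. r n < e"
  shows "limitin balls.mtopology (\<lambda>n. mcball (a n) (r n)) {l} sequentially"
  unfolding balls.limitin_metric
proof (intro conjI strip)
  have l: "l \<in> M"
    using a by (simp add: limitin_metric)
  then show lb: "{l} \<in> closed_balls"
    by (rule singleton_in_closed_balls)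
  have ball: "mcball (a n) (r n) \<in> closed_balls" for n
    using range_subsetD[OF aM] r[of n] unfolding closed_balls_def by blast
  fix e :: real assume "e > 0"
  then have e2: "e / 2 > 0"
    by simp
  have "\<forall>\<^sub>F n in sequentially. d (a n) l < e / 2"
    using a e2 unfolding limitin_metric by (blast intro: eventually_mono)
  then show "\<forall>\<^sub>F n in sequentially. mcball (a n) (r n) \<in> closed_balls \<and>
      hausdorff_dist (mcball (a n) (r n)) {l} < e"
    using small[OF e2]
  proof eventually_elim
    case (elim n)
    have near: "d x l \<le> max (r n) (d (a n) l)" if "x \<in> mcball (a n) (r n)" for x
      using that ultrametric[of x l "a n"] l by (auto simp: commute)
    have "a n \<in> mcball (a n) (r n)"
      using range_subsetD[OF aM] r by (simp only: centre_in_mcball_iff)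
    then have "hausdorff_dist (mcball (a n) (r n)) {l} \<le> max (r n) (d (a n) l)"
      using ball lb closed_balls_subset_CB near by (intro hausdorff_dist_le) blast+
    then show ?case
      using elim ball \<open>e > 0\<close> by auto
  qed
qed

section \<open>Bounded compactness passes from the points to the balls\<close>

lemma boundedly_compact_balls:
  assumes bc: "boundedly_compact"
  shows "balls.boundedly_compact"
  unfolding balls.boundedly_compact_def balls.compactin_sequentially
proof (intro strip conjI)
  fix S assume "closedin balls.mtopology S \<and> balls.mbounded S"
  then have cl: "closedin balls.mtopology S" and bdd: "balls.mbounded S"
    by auto
  show SM: "S \<subseteq> closed_balls"
    using bdd by (rule balls.mbounded_subset_mspace)
  obtain c R where "\<Union>S \<subseteq> mcball c R"
    using mbounded_Union_balls[OF bdd] by (auto simp: mbounded_def)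
  moreover define K where "K = mcball c R"
  ultimately have SK: "\<And>A. A \<in> S \<Longrightarrow> A \<subseteq> K"
    by blast
  have K: "compactin mtopology K"
    using bc mbounded_mcball closedin_mcball unfolding boundedly_compact_def K_def by blast
  fix \<sigma> :: "nat \<Rightarrow> 'a set" assume \<sigma>: "range \<sigma> \<subseteq> S"
  \<comment> \<open>A ball may have many centres and radii; one pair is fixed for each
    \<open>n\<close>, and the case distinction below concerns these chosen radii.\<close>
  then have "\<exists>a r. a \<in> M \<and> 0 \<le> r \<and> \<sigma> n = mcball a r" for n
    using SM range_subsetD[OF \<sigma>, of n] unfolding closed_balls_def by blast
  then obtain a r where ar: "\<And>n. a n \<in> M" "\<And>n. 0 \<le> r n" "\<And>n. \<sigma> n = mcball (a n) (r n)"
    by metis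
  have \<sigma>K: "\<sigma> n \<subseteq> K" for n
    using \<sigma> SK by blast
  show "\<exists>L s. L \<in> S \<and> strict_mono s \<and> limitin balls.mtopology (\<sigma> \<circ> s) L sequentially"
  proof (cases "\<exists>e>0. infinite {n. e \<le> r n}")
    case True
    then obtain e where e: "e > 0" "infinite {n. e \<le> r n}"
      by blast
    have "\<sigma> ` {n. e \<le> r n} \<subseteq> {A. A \<subseteq> K \<and> (\<exists>c r. c \<in> M \<and> e \<le> r \<and> A = mcball c r)}"
      using ar \<sigma>K by blast
    then have "finite (\<sigma> ` {n. e \<le> r n})"
      using finite_large_balls[OF compactin_imp_mtotally_bounded[OF K] e(1)] finite_subset by blast
    \<comment> \<open>Infinitely many indices but only finitely many balls: one ball recurs
      infinitely often and gives a constant subsequence.\<close>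
    then obtain m where "infinite {n \<in> {n. e \<le> r n}. \<sigma> n = \<sigma> m}"
      using pigeonhole_infinite[OF e(2)] by blast
    then obtain s :: "nat \<Rightarrow> nat" where s: "strict_mono s" "\<And>n. \<sigma> (s n) = \<sigma> m"
      using infinite_enumerate[of "{n \<in> {n. e \<le> r n}. \<sigma> n = \<sigma> m}"] by auto
    have m: "\<sigma> m \<in> S"
      using \<sigma> by blast
    have "\<sigma> \<circ> s = (\<lambda>n. \<sigma> m)"
      using s by auto
    then have "limitin balls.mtopology (\<sigma> \<circ> s) (\<sigma> m) sequentially"
      using m SM by auto
    with m s show ?thesis
      by blast
  next
    case False
    \<comment> \<open>Now \<open>e \<le> r n\<close> holds for only finitely many \<open>n\<close>,
      that is, the radii tend to 0.\<close>
    then have small: "\<forall>\<^sub>F n in sequentially. r n < e" if "e > 0" for e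
      using that unfolding cofinite_eq_sequentially[symmetric] eventually_cofinite not_less by blast
    \<comment> \<open>Each centre lies in its own ball, so compactness of \<open>K\<close> applies
      to the sequence of centres.\<close>
    have "a n \<in> K" for n
      using \<sigma>K[of n] ar by auto
    then have "range a \<subseteq> K"
      by blast
    then obtain l s where s: "strict_mono s" and l: "limitin mtopology (a \<circ> s) l sequentially"
      using K unfolding compactin_sequentially by meson
    have "limitin balls.mtopology (\<lambda>n. mcball ((a \<circ> s) n) ((r \<circ> s) n)) {l} sequentially"
      using l by (rule limitin_shrinking_balls)
        (use ar eventually_subseq[OF s small] in \<open>auto simp: o_def\<close>)
    then have lim: "limitin balls.mtopology (\<sigma> \<circ> s) {l} sequentially"
      by (simp add: ar(3) o_def)
    have "range (\<sigma> \<circ> s) \<subseteq> S"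
      using \<sigma> by auto
    with lim have "{l} \<in> S"
      using cl unfolding balls.metric_closedin_iff_sequentially_closed by blast
    with lim s show ?thesis
      by blast
  qed
qed

end

theorem theorem5p15:
  fixes X :: "'a set" and d :: "'a \<Rightarrow> 'a \<Rightarrow> real"
  assumes "Ultrametric_space X d"
  shows "Metric_space.boundedly_compact X d \<longleftrightarrow>
         Metric_space.boundedly_compact (Metric_space.closed_balls X d)
           (Metric_space.hausdorff_dist X d)"
proof -
  interpret Ultrametric_space X d
    by (rule assms)
  show ?thesis
    using boundedly_compact_balls boundedly_compact_if_balls by blast
qed

end
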